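(* For the probing version of $K$-median clustering in which centers may be input nodes (arbitrary centers), the adaptivity gap is polynomially large on both distance and probing cost: there exist a constant $\delta>0$ and a family of instances with arbitrarily large number $n$ of nodes such that each instance admits an adaptive probing policy with expected probing cost $C_n$ and expected clustering cost $D_n>0$, while every non-adaptive policy on that instance (which chooses a set of nodes to probe in advance) either has probing cost at least $n^{\delta}C_n$ or expected clustering cost at least $n^{\delta}D_n$.
   Context: $(\mathcal{P},l)$ is a finite metric space (here in $\mathbb{R}^2$). There are $n$ input nodes; the location of node $i$ is an independent random variable $X_i$ over $\mathcal{P}$ with explicitly given discrete distribution; probing node $i$ costs $c_i\ge 0$ and reveals its location. Define a metric $d$ on $\mathcal{P}\cup\{\text{nodes}\}$: $d(p,q)=l(p,q)$ for points, $d(p,i)=\mathbb{E}[l(p,X_i)]$ for a point $p$ and node $i$, $d(i,j)=\mathbb{E}[l(X_i,X_j)]$ for distinct nodes, and $d(i,i)=0$. After probing a set $S$ of nodes with outcome $\mathbf{v}_S$, the algorithm opens exactly $K$ centers, each either a point of $\mathcal{P}$ or an unprobed node, and assigns every node to a center; the clustering cost is $\sum_{i\in S}d(\mathbf{v}_i,f(i))+\sum_{i\notin S}d(i,f(i))$ where $f(i)$ is the center assigned to $i$; centers and assignments are chosen minimizing this cost. An adaptive policy chooses probes sequentially depending on outcomes; its probing cost and clustering cost are taken in expectation over outcomes. *)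

theory Defs
  imports "HOL-Probability.Probability"
begin

text \<open>The nodes of an instance are the numbers below \<open>num_nodes\<close>; the metric on the points is the
  Euclidean one.\<close>

record probing_instance =
  points :: "(real^2) set"
  num_nodes :: nat
  node_distr :: "nat \<Rightarrow> (real^2) pmf"
  probe_cost :: "nat \<Rightarrow> real"
  num_centers :: nat

definition nodes :: "probing_instance \<Rightarrow> nat set" where
  "nodes I = {..<num_nodes I}"

text \<open>The last conjunct makes opening exactly \<open>num_centers\<close> distinct centers possible whichever
  nodes have been probed.\<close>

definition valid_instance :: "probing_instance \<Rightarrow> bool" where
  "valid_instance I \<longleftrightarrow>
     finite (points I) \<and>
     (\<forall>i\<in>nodes I. set_pmf (node_distr I i) \<subseteq> points I \<and> 0 \<le> probe_cost I i) \<and>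
     1 \<le> num_centers I \<and> num_centers I \<le> card (points I)"

datatype site = PointSite "real^2" | NodeSite nat

fun site_dist :: "probing_instance \<Rightarrow> site \<Rightarrow> site \<Rightarrow> real" where
  "site_dist I (PointSite p) (PointSite q) = dist p q"
| "site_dist I (PointSite p) (NodeSite i) =
     measure_pmf.expectation (node_distr I i) (\<lambda>x. dist p x)"
| "site_dist I (NodeSite i) (PointSite p) =
     measure_pmf.expectation (node_distr I i) (\<lambda>x. dist x p)"
| "site_dist I (NodeSite i) (NodeSite j) =
     (if i = j then 0
      else measure_pmf.expectation (pair_pmf (node_distr I i) (node_distr I j))
             (\<lambda>(x, y). dist x y))"

text \<open>In the following, \<open>v\<close> assigns a location to every node, but only its values on the set \<open>S\<close> of
  probed nodes are used.\<close>

definition assignment_cost ::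
  "probing_instance \<Rightarrow> nat set \<Rightarrow> (nat \<Rightarrow> real^2) \<Rightarrow> (nat \<Rightarrow> site) \<Rightarrow> real" where
  "assignment_cost I S v f =
     (\<Sum>i\<in>nodes I \<inter> S. site_dist I (PointSite (v i)) (f i)) +
     (\<Sum>i\<in>nodes I - S. site_dist I (NodeSite i) (f i))"

definition clusterings :: "probing_instance \<Rightarrow> nat set \<Rightarrow> (site set \<times> (nat \<Rightarrow> site)) set" where
  "clusterings I S =
     {(A, f). A \<subseteq> PointSite ` points I \<union> NodeSite ` (nodes I - S) \<and> card A = num_centers I \<and>
              f \<in> nodes I \<rightarrow>\<^sub>E A}"

definition clustering_cost ::
  "probing_instance \<Rightarrow> nat set \<Rightarrow> (nat \<Rightarrow> real^2) \<Rightarrow> real" where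
  "clustering_cost I S v = Min ((\<lambda>(A, f). assignment_cost I S v f) ` clusterings I S)"

lemma finite_clusterings:
  assumes "valid_instance I"
  shows "finite (clusterings I S)"
proof -
  let ?U = "PointSite ` points I \<union> NodeSite ` (nodes I - S)"
  have "finite ?U"
    using assms by (simp add: valid_instance_def nodes_def)
  moreover have "clusterings I S \<subseteq> Pow ?U \<times> (nodes I \<rightarrow>\<^sub>E ?U)"
  proof (rule subrelI)
    fix A f
    assume "(A, f) \<in> clusterings I S"
    then have "A \<subseteq> ?U" "f \<in> nodes I \<rightarrow>\<^sub>E A"
      by (simp_all add: clusterings_def)
    then show "(A, f) \<in> Pow ?U \<times> (nodes I \<rightarrow>\<^sub>E ?U)"
      using PiE_mono[of "nodes I" "\<lambda>_. A" "\<lambda>_. ?U"] by blast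
  qed
  moreover have "finite (nodes I)"
    by (simp add: nodes_def)
  ultimately show ?thesis
    using finite_subset[of "clusterings I S" "Pow ?U \<times> (nodes I \<rightarrow>\<^sub>E ?U)"]
    by (simp add: finite_PiE)
qed

lemma clusterings_nonempty:
  assumes "valid_instance I"
  shows "clusterings I S \<noteq> {}"
proof -
  obtain B where B: "B \<subseteq> points I" "card B = num_centers I"
    using assms obtain_subset_with_card_n unfolding valid_instance_def by metis
  then obtain b where "b \<in> B"
    using assms by (fastforce simp: valid_instance_def)
  have "card (PointSite ` B) = num_centers I"
    using B by (simp add: card_image inj_on_def)
  then have "(PointSite ` B, \<lambda>i\<in>nodes I. PointSite b) \<in> clusterings I S"
    using B \<open>b \<in> B\<close> by (auto simp: clusterings_def)
  then show ?thesis by blast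
qed

definition joint_distr :: "probing_instance \<Rightarrow> (nat \<Rightarrow> real^2) pmf" where
  "joint_distr I = Pi_pmf (nodes I) 0 (node_distr I)"

text \<open>An adaptive policy is a decision tree: either stop probing, or probe a node and continue
  depending on the revealed location.\<close>

datatype policy = Stop | Probe nat "real^2 \<Rightarrow> policy"

primrec valid_policy :: "nat set \<Rightarrow> policy \<Rightarrow> bool" where
  "valid_policy U Stop = True"
| "valid_policy U (Probe i g) = (i \<in> U \<and> (\<forall>x. valid_policy (U - {i}) (g x)))"

primrec probed :: "policy \<Rightarrow> (nat \<Rightarrow> real^2) \<Rightarrow> nat set" where
  "probed Stop v = {}"
| "probed (Probe i g) v = insert i (probed (g (v i)) v)"

definition adaptive_probing_cost :: "probing_instance \<Rightarrow> policy \<Rightarrow> real" where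
  "adaptive_probing_cost I \<pi> =
     measure_pmf.expectation (joint_distr I) (\<lambda>v. \<Sum>i\<in>probed \<pi> v. probe_cost I i)"

definition adaptive_clustering_cost :: "probing_instance \<Rightarrow> policy \<Rightarrow> real" where
  "adaptive_clustering_cost I \<pi> =
     measure_pmf.expectation (joint_distr I) (\<lambda>v. clustering_cost I (probed \<pi> v) v)"

definition nonadaptive_probing_cost :: "probing_instance \<Rightarrow> nat set \<Rightarrow> real" where
  "nonadaptive_probing_cost I S = (\<Sum>i\<in>S. probe_cost I i)"

definition nonadaptive_clustering_cost :: "probing_instance \<Rightarrow> nat set \<Rightarrow> real" where
  "nonadaptive_clustering_cost I S =
     measure_pmf.expectation (joint_distr I) (\<lambda>v. clustering_cost I S v)"

end

theory Submission
  imports Defs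
begin

text \<open>
  Let \<open>K = 2\<close>. Node \<open>0\<close> is free to probe and lies at a unit vector \<open>e\<close> with probability \<open>q = 1/n\<close>,
  otherwise at \<open>\<epsilon> e\<close> for \<open>\<epsilon> = q^3\<close>. Node \<open>1\<close> costs \<open>1\<close> to probe and lies at \<open>e\<close> or \<open>0\<close> with
  probability \<open>1/2\<close> each. All other nodes lie at \<open>0\<close>. If node \<open>0\<close> is found near \<open>0\<close>, then \<open>0\<close>
  and the unprobed node \<open>1\<close> itself are good centers, at cost \<open>\<epsilon>\<close>; only if node \<open>0\<close> is at \<open>e\<close> are
  the centers \<open>0\<close> and \<open>e\<close> needed, and with node \<open>1\<close> probed they cost \<open>0\<close>. So an adaptive policy has
  expected probing cost \<open>q\<close> and clustering cost at most \<open>\<epsilon>\<close>. A non-adaptive policy either pays \<open>1\<close>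
  for node \<open>1\<close>, or with probability \<open>q\<close> has clustering cost at least \<open>q\<close>. Either way it loses a
  factor \<open>n\<close>, so \<open>\<delta> = 1\<close> works.

  The lower bounds replace every site by its expected location, which does not increase distances.
\<close>

section \<open>Lower bounds from expected locations\<close>

fun site_mean :: "probing_instance \<Rightarrow> site \<Rightarrow> real^2" where
  "site_mean I (PointSite p) = p"
| "site_mean I (NodeSite i) = measure_pmf.expectation (node_distr I i) (\<lambda>x. x)"

text \<open>Jensen's inequality for the norm: \<open>p\<close> and \<open>q\<close> are the
  marginals of \<open>pair_pmf p q\<close>, so the difference of the means is the mean of the
  difference.\<close>

lemma dist_expectation_le:
  fixes p q :: "'a::{banach, second_countable_topology} pmf"
  assumes p: "finite (set_pmf p)" and q: "finite (set_pmf q)"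
  shows "dist (measure_pmf.expectation p (\<lambda>x. x)) (measure_pmf.expectation q (\<lambda>x. x))
           \<le> measure_pmf.expectation (pair_pmf p q) (\<lambda>(x, y). dist x y)"
proof -
  have int: "integrable (measure_pmf (pair_pmf p q)) f" for f :: "'a \<times> 'a \<Rightarrow> 'a"
    by (rule integrable_measure_pmf_finite) (simp add: p q)
  have "measure_pmf.expectation p (\<lambda>x. x) = measure_pmf.expectation (pair_pmf p q) fst"
    by (subst map_fst_pair_pmf[of p q, symmetric]) (simp del: map_fst_pair_pmf)
  moreover have "measure_pmf.expectation q (\<lambda>x. x) = measure_pmf.expectation (pair_pmf p q) snd"
    by (subst map_snd_pair_pmf[of p q, symmetric]) (simp del: map_snd_pair_pmf)
  ultimately have "dist (measure_pmf.expectation p (\<lambda>x. x)) (measure_pmf.expectation q (\<lambda>x. x))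
      = norm (measure_pmf.expectation (pair_pmf p q) (\<lambda>z. fst z - snd z))"
    by (simp add: dist_norm int)
  also have "\<dots> \<le> measure_pmf.expectation (pair_pmf p q) (\<lambda>z. norm (fst z - snd z))"
    by (rule integral_norm_bound)
  finally show ?thesis
    by (simp only: case_prod_unfold dist_norm)
qed

text \<open>A point is the mean of \<open>return_pmf\<close> at that point, so the mixed cases also
  reduce to \<open>dist_expectation_le\<close>.\<close>

lemma dist_site_mean_le:
  assumes "\<And>i. finite (set_pmf (node_distr I i))"
  shows "dist (site_mean I s) (site_mean I t) \<le> site_dist I s t"
proof (cases s; cases t)
  fix p i assume "s = PointSite p" "t = NodeSite i"
  then show ?thesis
    using dist_expectation_le[of "return_pmf p" "node_distr I i"] assms
    by (simp add: pair_return_pmf1)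
next
  fix p i assume "s = NodeSite i" "t = PointSite p"
  then show ?thesis
    using dist_expectation_le[of "node_distr I i" "return_pmf p"] assms
    by (simp add: pair_return_pmf2)
qed (auto intro: dist_expectation_le assms)

definition mean_location ::
  "probing_instance \<Rightarrow> nat set \<Rightarrow> (nat \<Rightarrow> real^2) \<Rightarrow> nat \<Rightarrow> real^2" where
  "mean_location I S v i = site_mean I (if i \<in> S then PointSite (v i) else NodeSite i)"

text \<open>Holds termwise: \<open>mean_location I S v i\<close> is the mean of exactly the site
  from which the cost measures node \<open>i\<close>.\<close>

lemma assignment_cost_ge:
  assumes "\<And>i. finite (set_pmf (node_distr I i))"
  shows "(\<Sum>i\<in>nodes I. dist (mean_location I S v i) (site_mean I (f i)))
           \<le> assignment_cost I S v f"
proof -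
  have "(\<Sum>i\<in>nodes I. dist (mean_location I S v i) (site_mean I (f i)))
      = (\<Sum>i\<in>nodes I \<inter> S. dist (mean_location I S v i) (site_mean I (f i)))
        + (\<Sum>i\<in>nodes I - S. dist (mean_location I S v i) (site_mean I (f i)))"
    by (rule sum.Int_Diff) (simp add: nodes_def)
  also have "\<dots> \<le> assignment_cost I S v f"
    unfolding assignment_cost_def mean_location_def
    by (intro add_mono sum_mono) (use dist_site_mean_le[OF assms, where s = "PointSite _"]
           dist_site_mean_le[OF assms, where s = "NodeSite _"] in auto)
  finally show ?thesis .
qed

text \<open>By the pigeonhole principle, two of any three nodes share one of the two centers.\<close>

lemma clustering_cost_ge:
  assumes "valid_instance I" "num_centers I = 2"
    and fin: "\<And>i. finite (set_pmf (node_distr I i))"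
    and T: "T \<subseteq> nodes I" "card T = 3"
    and sep: "\<And>i j. i \<in> T \<Longrightarrow> j \<in> T \<Longrightarrow> i \<noteq> j \<Longrightarrow>
                r \<le> dist (mean_location I S v i) (mean_location I S v j)"
  shows "r \<le> clustering_cost I S v"
proof -
  have "r \<le> assignment_cost I S v f" if "(A, f) \<in> clusterings I S" for A f
  proof -
    have A: "card A = 2" "f ` T \<subseteq> A"
      using that T(1) assms(2) by (auto simp: clusterings_def)
    have "finite A"
      using A(1) by (simp add: card_ge_0_finite)
    then have "\<not> inj_on f T"
      using card_inj_on_le[of f T A] A T(2) by auto
    then obtain i j where ij: "i \<in> T" "j \<in> T" "i \<noteq> j" "f i = f j"
      by (auto simp: inj_on_def)
    let ?d = "\<lambda>i. dist (mean_location I S v i) (site_mean I (f i))"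
    have "r \<le> dist (mean_location I S v i) (mean_location I S v j)"
      using sep ij by blast
    \<comment> \<open>The shared center has a single mean location, so the triangle inequality
      through it charges the separation to \<open>i\<close> and \<open>j\<close>.\<close>
    also have "\<dots> \<le> ?d i + ?d j"
      using ij(4) dist_triangle2[of _ _ "site_mean I (f j)"] by simp
    also have "\<dots> = (\<Sum>k\<in>{i, j}. ?d k)"
      using ij(3) by simp
    also have "\<dots> \<le> (\<Sum>k\<in>nodes I. ?d k)"
      using ij T(1) by (intro sum_mono2) (auto simp: nodes_def)
    also have "\<dots> \<le> assignment_cost I S v f"
      by (rule assignment_cost_ge[OF fin])
    finally show ?thesis .
  qed
  then show ?thesis
    unfolding clustering_cost_def
    using finite_clusterings[OF assms(1)] clusterings_nonempty[OF assms(1)]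
    by (intro Min.boundedI) auto
qed

lemma clustering_cost_le:
  assumes "valid_instance I" "(A, f) \<in> clusterings I S"
  shows "clustering_cost I S v \<le> assignment_cost I S v f"
  unfolding clustering_cost_def
  using finite_clusterings[OF assms(1)] assms(2) by (intro Min_le) force+

section \<open>The joint distribution of the locations\<close>

lemma finite_set_joint_distr:
  assumes "\<And>i. finite (set_pmf (node_distr I i))"
  shows "finite (set_pmf (joint_distr I))"
  by (auto simp: joint_distr_def set_Pi_pmf nodes_def assms intro!: finite_PiE_dflt)

lemma set_joint_distr_component:
  assumes "v \<in> set_pmf (joint_distr I)" "i \<in> nodes I"
  shows "v i \<in> set_pmf (node_distr I i)"
  using assms by (auto simp: joint_distr_def set_Pi_pmf nodes_def PiE_dflt_def)

lemma prob_joint_distr_component: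
  assumes "i \<in> nodes I"
  shows "measure_pmf.prob (joint_distr I) {v. v i = x} = pmf (node_distr I i) x"
proof -
  have "map_pmf (\<lambda>v. v i) (joint_distr I) = node_distr I i"
    using assms Pi_pmf_component[of "nodes I" i 0 "node_distr I"]
    by (simp add: joint_distr_def nodes_def)
  then show ?thesis
    using pmf_map[of "\<lambda>v. v i" "joint_distr I" x] by (simp add: vimage_def)
qed

text \<open>A Markov-type bound: on the support, \<open>F\<close> dominates \<open>r\<close> times
  the indicator of the event \<open>v i = x\<close>.\<close>

lemma expectation_joint_distr_ge:
  assumes fin: "\<And>i. finite (set_pmf (node_distr I i))"
    and i: "i \<in> nodes I"
    and nonneg: "\<And>v. v \<in> set_pmf (joint_distr I) \<Longrightarrow> 0 \<le> F v"
    and ge: "\<And>v. v \<in> set_pmf (joint_distr I) \<Longrightarrow> v i = x \<Longrightarrow> r \<le> F v"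
  shows "r * pmf (node_distr I i) x \<le> measure_pmf.expectation (joint_distr I) F"
proof -
  have int: "integrable (measure_pmf (joint_distr I)) f" for f :: "_ \<Rightarrow> real"
    by (rule integrable_measure_pmf_finite) (rule finite_set_joint_distr[OF fin])
  have "r * pmf (node_distr I i) x
      = measure_pmf.expectation (joint_distr I) (\<lambda>v. r * indicator {v. v i = x} v)"
    by (simp add: prob_joint_distr_component[OF i])
  also have "\<dots> \<le> measure_pmf.expectation (joint_distr I) F"
    using nonneg ge by (intro integral_mono_AE int) (auto simp: AE_measure_pmf_iff indicator_def)
  finally show ?thesis .
qed

section \<open>Two-point distributions on a line\<close>

definition unit_vector :: "real^2" where
  "unit_vector = axis 1 1"

lemma unit_vector [simp]: "norm unit_vector = 1" "unit_vector \<noteq> 0"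
  by (auto simp: unit_vector_def axis_eq_0_iff)

lemma dist_scaleR_unit_vector [simp]:
  "dist (a *\<^sub>R unit_vector) (b *\<^sub>R unit_vector) = \<bar>a - b\<bar>"
  "dist (a *\<^sub>R unit_vector) 0 = \<bar>a\<bar>"
  "dist 0 (a *\<^sub>R unit_vector) = \<bar>a\<bar>"
  "dist unit_vector (a *\<^sub>R unit_vector) = \<bar>1 - a\<bar>"
  "dist (a *\<^sub>R unit_vector) unit_vector = \<bar>a - 1\<bar>"
proof -
  show *: "dist (a *\<^sub>R unit_vector) (b *\<^sub>R unit_vector) = \<bar>a - b\<bar>" for a b
    by (simp add: dist_norm flip: scaleR_diff_left)
  show "dist unit_vector (a *\<^sub>R unit_vector) = \<bar>1 - a\<bar>"
    "dist (a *\<^sub>R unit_vector) unit_vector = \<bar>a - 1\<bar>"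
    using *[of 1 a] *[of a 1] by simp_all
qed (simp_all add: dist_norm)

lemma scaleR_unit_vector_eq_iff [simp]:
  "a *\<^sub>R unit_vector = unit_vector \<longleftrightarrow> a = 1"
  "unit_vector = a *\<^sub>R unit_vector \<longleftrightarrow> a = 1"
  using scaleR_cancel_right[of a unit_vector 1] by auto

text \<open>One shape for both random nodes of the construction. All locations are multiples of one
  unit vector, so distances become absolute differences of reals.\<close>

definition two_point :: "real \<Rightarrow> real \<Rightarrow> (real^2) pmf" where
  "two_point p a = map_pmf (\<lambda>c. if c then unit_vector else a *\<^sub>R unit_vector) (bernoulli_pmf p)"

lemma set_two_point: "set_pmf (two_point p a) \<subseteq> {unit_vector, a *\<^sub>R unit_vector}"
  by (auto simp: two_point_def)

lemma expectation_two_point: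
  assumes "0 \<le> p" "p \<le> 1"
  shows "measure_pmf.expectation (two_point p a) (\<lambda>x. x) = (p + (1 - p) * a) *\<^sub>R unit_vector"
  using assms by (simp add: two_point_def integral_measure_pmf[of UNIV] UNIV_bool algebra_simps)

text \<open>With \<open>a \<noteq> 1\<close> the two locations differ, so their masses do not
  merge.\<close>

lemma pmf_two_point:
  assumes "0 \<le> p" "p \<le> 1" "a \<noteq> 1"
  shows "pmf (two_point p a) unit_vector = p" "pmf (two_point p a) (a *\<^sub>R unit_vector) = 1 - p"
proof -
  have "(\<lambda>c. if c then unit_vector else a *\<^sub>R unit_vector) -` {unit_vector} = {True}"
    "(\<lambda>c. if c then unit_vector else a *\<^sub>R unit_vector) -` {a *\<^sub>R unit_vector} = {False}"
    using assms(3) by (auto split: if_splits)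
  then show "pmf (two_point p a) unit_vector = p"
    "pmf (two_point p a) (a *\<^sub>R unit_vector) = 1 - p"
    using assms(1,2) by (simp_all add: two_point_def pmf_map measure_pmf_single)
qed

section \<open>The gap instance\<close>

definition gap_instance :: "nat \<Rightarrow> real \<Rightarrow> real \<Rightarrow> probing_instance" where
  "gap_instance n q \<epsilon> =
     \<lparr>points = {0, unit_vector, \<epsilon> *\<^sub>R unit_vector},
      num_nodes = n,
      node_distr = (\<lambda>i. if i = 0 then two_point q \<epsilon> else if i = 1 then two_point (1/2) 0
                        else return_pmf 0),
      probe_cost = (\<lambda>i. if i = 1 then 1 else 0),
      num_centers = 2\<rparr>"

definition gap_policy :: policy where
  "gap_policy = Probe 0 (\<lambda>x. if x = unit_vector then Probe 1 (\<lambda>_. Stop) else Stop)"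

lemma probed_gap_policy: "probed gap_policy v = (if v 0 = unit_vector then {0, 1} else {0})"
  by (simp add: gap_policy_def)

context
  fixes n :: nat and q \<epsilon> :: real and I :: probing_instance
  assumes n: "3 \<le> n" and q: "0 < q" "q \<le> 1/8" and \<epsilon>: "0 < \<epsilon>" "\<epsilon> \<le> 1/8"
  defines "I \<equiv> gap_instance n q \<epsilon>"
begin

lemma gap_instance_sel [simp]:
  "points I = {0, unit_vector, \<epsilon> *\<^sub>R unit_vector}"
  "num_nodes I = n" "nodes I = {..<n}" "num_centers I = 2"
  "node_distr I 0 = two_point q \<epsilon>" "node_distr I (Suc 0) = two_point (1/2) 0"
  "2 \<le> i \<Longrightarrow> node_distr I i = return_pmf 0"
  "probe_cost I i = (if i = 1 then 1 else 0)"
  by (simp_all add: I_def gap_instance_def nodes_def)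

lemma scaled_neq: "\<epsilon> *\<^sub>R unit_vector \<noteq> unit_vector"
  using \<epsilon> by simp

lemma node_distr_subset: "set_pmf (node_distr I i) \<subseteq> points I"
  using set_two_point[of q \<epsilon>] set_two_point[of "1/2" 0]
  by (cases "i = 0"; cases "i = 1") (auto simp: I_def gap_instance_def)

lemma finite_node_distr: "finite (set_pmf (node_distr I i))"
  by (rule finite_subset[OF node_distr_subset]) simp

lemma valid_gap_instance: "valid_instance I"
  using node_distr_subset scaled_neq \<epsilon> by (simp add: valid_instance_def card_insert_if)

text \<open>The pigeonhole bound for the two random nodes and one node fixed at the origin, which
  exists since \<open>3 \<le> n\<close>.\<close>

lemma clustering_cost_gap_ge:
  assumes "r \<le> dist (mean_location I S v 0) (mean_location I S v 1)"
    and "r \<le> dist (mean_location I S v 0) (mean_location I S v 2)"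
    and "r \<le> dist (mean_location I S v 1) (mean_location I S v 2)"
  shows "r \<le> clustering_cost I S v"
proof (rule clustering_cost_ge)
  show "r \<le> dist (mean_location I S v i) (mean_location I S v j)"
    if "i \<in> {0, 1, 2}" "j \<in> {0, 1, 2}" "i \<noteq> j" for i j :: nat
    using that assms by (auto simp: dist_commute)
qed (use n in \<open>auto intro: valid_gap_instance finite_node_distr\<close>)

lemma clustering_cost_nonneg: "0 \<le> clustering_cost I S v"
  by (rule clustering_cost_gap_ge) simp_all

lemma mean_location_two:
  assumes "v \<in> set_pmf (joint_distr I)"
  shows "mean_location I S v 2 = 0"
  using set_joint_distr_component[OF assms, of 2] n by (simp add: mean_location_def)

lemma mean_location_one: "1 \<notin> S \<Longrightarrow> mean_location I S v 1 = (1/2) *\<^sub>R unit_vector"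
  by (simp add: mean_location_def expectation_two_point)

section \<open>Costs of the adaptive policy\<close>

lemma adaptive_probing_cost_gap: "adaptive_probing_cost I gap_policy = q"
proof -
  have "adaptive_probing_cost I gap_policy
      = measure_pmf.expectation (joint_distr I) (indicator {v. v 0 = unit_vector})"
    \<comment> \<open>Node \<open>0\<close> is free, so the cost is the indicator of the event that
      node \<open>1\<close> gets probed.\<close>
    unfolding adaptive_probing_cost_def probed_gap_policy
    by (intro Bochner_Integration.integral_cong) (auto simp: indicator_def)
  also have "\<dots> = q"
    using n q \<epsilon> by (simp add: prob_joint_distr_component pmf_two_point)
  finally show ?thesis .
qed

lemma clustering_cost_adaptive_le:
  assumes v: "v \<in> set_pmf (joint_distr I)"
  shows "clustering_cost I (probed gap_policy v) v \<le> \<epsilon>"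
proof -
  have v0: "v 0 = unit_vector \<or> v 0 = \<epsilon> *\<^sub>R unit_vector"
    using set_joint_distr_component[OF v, of 0] set_two_point n by fastforce
  have v1: "v 1 = unit_vector \<or> v 1 = 0"
    using set_joint_distr_component[OF v, of 1] set_two_point[of "1/2" 0] n by fastforce
  show ?thesis
  proof (cases "v 0 = unit_vector")
    case True
    \<comment> \<open>Both probed nodes lie exactly on centers, and the remaining nodes are fixed at
      the origin.\<close>
    define f where
      "f = (\<lambda>i\<in>nodes I. if i \<in> {0, 1} then PointSite (v i) else PointSite 0)"
    have "({PointSite 0, PointSite unit_vector}, f) \<in> clusterings I {0, 1}"
      using True v1 unfolding clusterings_def f_def by (auto split: if_splits)
    moreover have "assignment_cost I {0, 1} v f = 0"
      unfolding assignment_cost_def f_def by (auto intro!: sum.neutral simp: numeral_2_eq_2)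
    ultimately show ?thesis
      using clustering_cost_le[OF valid_gap_instance, of _ f "{0, 1}" v] True \<epsilon>
      by (fastforce simp: probed_gap_policy)
  next
    case False
    \<comment> \<open>Node \<open>1\<close> as its own center is at distance 0 by definition,
      wherever it lies; only node \<open>0\<close> pays, namely \<epsilon>.\<close>
    define f where "f = (\<lambda>i\<in>nodes I. if i = 1 then NodeSite 1 else PointSite 0)"
    have "({PointSite 0, NodeSite 1}, f) \<in> clusterings I {0}"
      using n unfolding clusterings_def f_def by auto
    moreover have "assignment_cost I {0} v f = \<epsilon>"
    proof -
      have "{..<n} \<inter> {0} = {0}"
        using n by auto
      moreover have "(\<Sum>i\<in>{..<n} - {0}. site_dist I (NodeSite i) (f i)) = 0"
      proof (rule sum.neutral, rule ballI)
        fix i assume "i \<in> {..<n} - {0}"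
        then show "site_dist I (NodeSite i) (f i) = 0"
          by (cases "i = 1") (simp_all add: f_def)
      qed
      ultimately show ?thesis
        using False v0 n \<epsilon> by (simp add: assignment_cost_def f_def)
    qed
    ultimately show ?thesis
      using clustering_cost_le[OF valid_gap_instance, of _ f "{0}" v] False
      by (fastforce simp: probed_gap_policy)
  qed
qed

lemma adaptive_clustering_cost_gap_le: "adaptive_clustering_cost I gap_policy \<le> \<epsilon>"
  unfolding adaptive_clustering_cost_def
  by (intro measure_pmf.integral_le_const integrable_measure_pmf_finite
        finite_set_joint_distr finite_node_distr)
     (simp add: AE_measure_pmf_iff clustering_cost_adaptive_le)

text \<open>Makes the ratio of clustering costs meaningful. If node \<open>0\<close> is found near
  the origin, the mean locations of nodes \<open>0\<close>, \<open>1\<close>, \<open>2\<close> have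
  coordinates \<epsilon>, 1/2 and 0, which are pairwise at least \<epsilon> apart.\<close>

lemma adaptive_clustering_cost_gap_pos: "0 < adaptive_clustering_cost I gap_policy"
proof -
  have "\<epsilon> \<le> clustering_cost I (probed gap_policy v) v"
    if v: "v \<in> set_pmf (joint_distr I)" "v 0 = \<epsilon> *\<^sub>R unit_vector" for v
  proof -
    have "mean_location I {0} v 0 = \<epsilon> *\<^sub>R unit_vector"
      using v(2) by (simp add: mean_location_def)
    then have "\<epsilon> \<le> clustering_cost I {0} v"
      using mean_location_two[OF v(1), of "{0}"] mean_location_one[of "{0}" v] \<epsilon>
      by (intro clustering_cost_gap_ge) simp_all
    then show ?thesis
      using v(2) scaled_neq by (simp add: probed_gap_policy)
  qed
  then have "\<epsilon> * pmf (node_distr I 0) (\<epsilon> *\<^sub>R unit_vector) \<le> adaptive_clustering_cost I gap_policy"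
    unfolding adaptive_clustering_cost_def
    using n by (intro expectation_joint_distr_ge finite_node_distr clustering_cost_nonneg) auto
  moreover have "0 < \<epsilon> * pmf (node_distr I 0) (\<epsilon> *\<^sub>R unit_vector)"
    using q \<epsilon> by (simp add: pmf_two_point)
  ultimately show ?thesis
    by linarith
qed

section \<open>Lower bounds for non-adaptive policies\<close>

lemma nonadaptive_clustering_cost_gap_ge:
  assumes "1 \<notin> S"
  shows "q * q \<le> nonadaptive_clustering_cost I S"
proof -
  \<comment> \<open>The coordinate of the mean of node \<open>0\<close>. The bounds 1/8 on
    \<open>q\<close> and \<epsilon> keep it at most 1/4, away from the mean 1/2 of node
    \<open>1\<close>.\<close>
  define \<mu> where "\<mu> = q + (1 - q) * \<epsilon>"
  have "0 \<le> (1 - q) * \<epsilon>" "(1 - q) * \<epsilon> \<le> \<epsilon>"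
    using q \<epsilon> by (auto intro: mult_left_le_one_le)
  then have \<mu>: "q \<le> \<mu>" "\<mu> \<le> 1/4"
    using q \<epsilon> unfolding \<mu>_def by linarith+
  \<comment> \<open>Node \<open>0\<close> counts as lying at 1 if probed and at \<mu> otherwise;
    either is at least \<open>q\<close> away from both 0 and 1/2. The event has probability
    \<open>q\<close>, which gives the second factor.\<close>
  have "q \<le> clustering_cost I S v"
    if v: "v \<in> set_pmf (joint_distr I)" "v 0 = unit_vector" for v
  proof -
    have "mean_location I S v 0 = (if 0 \<in> S then 1 else \<mu>) *\<^sub>R unit_vector"
      using v(2) q by (simp add: mean_location_def expectation_two_point \<mu>_def)
    then show ?thesis
      using mean_location_two[OF v(1), of S] mean_location_one[OF assms, of v] q \<mu>
      by (intro clustering_cost_gap_ge) (simp_all split: if_splits)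
  qed
  then have "q * pmf (node_distr I 0) unit_vector \<le> nonadaptive_clustering_cost I S"
    unfolding nonadaptive_clustering_cost_def
    using n by (intro expectation_joint_distr_ge finite_node_distr clustering_cost_nonneg) auto
  then show ?thesis
    using q \<epsilon> by (simp add: pmf_two_point)
qed

lemma nonadaptive_probing_cost_gap:
  assumes "S \<subseteq> nodes I" "1 \<in> S"
  shows "nonadaptive_probing_cost I S = 1"
proof -
  \<comment> \<open>Needed because a sum over an infinite set is 0 by default.\<close>
  have "finite S"
    using assms(1) finite_subset by auto
  then show ?thesis
    using assms(2) by (simp add: nonadaptive_probing_cost_def)
qed

end

theorem theorem7:
  shows "\<exists>\<delta>::real. 0 < \<delta> \<and> (\<forall>N::nat. \<exists>I \<pi>.
     N \<le> num_nodes I \<and> valid_instance I \<and> valid_policy (nodes I) \<pi> \<and>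
     0 < adaptive_probing_cost I \<pi> \<and> 0 < adaptive_clustering_cost I \<pi> \<and>
     (\<forall>S\<subseteq>nodes I.
        real (num_nodes I) powr \<delta> * adaptive_probing_cost I \<pi> \<le> nonadaptive_probing_cost I S \<or>
        real (num_nodes I) powr \<delta> * adaptive_clustering_cost I \<pi> \<le> nonadaptive_clustering_cost I S))"
proof (intro exI[of _ "1::real"] conjI allI)
  fix N :: nat
  \<comment> \<open>The 8 gives \<open>q \<le> 1/8\<close>, and \<open>q = 1 / n\<close> makes the
    probing costs \<open>q\<close> and 1 differ by the factor \<open>n\<close>.\<close>
  define n where "n = max 8 N"
  define q where "q = 1 / real n"
  \<comment> \<open>The cube makes \<open>n\<close> times the adaptive clustering bound equal to
    \<open>q * q\<close>, the non-adaptive lower bound.\<close>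
  define I where "I = gap_instance n q (q ^ 3)"
  have n: "8 \<le> n" "3 \<le> n" "N \<le> n"
    by (auto simp: n_def)
  have q: "0 < q" "q \<le> 1/8"
    using n by (auto simp: q_def field_simps)
  have \<epsilon>: "0 < q ^ 3" "q ^ 3 \<le> 1/8"
    using q power_decreasing[of 1 3 q] by auto
  note params = n(2) q \<epsilon>
  have nq: "real n * q = 1"
    using n by (simp add: q_def)
  have "n * adaptive_probing_cost I gap_policy \<le> nonadaptive_probing_cost I S \<or>
      n * adaptive_clustering_cost I gap_policy \<le> nonadaptive_clustering_cost I S"
    if S: "S \<subseteq> nodes I" for S
  proof (cases "1 \<in> S")
    case True
    then show ?thesis
      using nonadaptive_probing_cost_gap[OF params, folded I_def, OF S]
        adaptive_probing_cost_gap[OF params, folded I_def] nq by simp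
  next
    case False
    have "n * adaptive_clustering_cost I gap_policy \<le> n * q ^ 3"
      using adaptive_clustering_cost_gap_le[OF params, folded I_def] by (intro mult_left_mono) auto
    also have "\<dots> = q * q"
      using nq by (simp add: power3_eq_cube flip: mult.assoc)
    also have "\<dots> \<le> nonadaptive_clustering_cost I S"
      using nonadaptive_clustering_cost_gap_ge[OF params, folded I_def, OF False] .
    finally show ?thesis by simp
  qed
  moreover have "num_nodes I = n" "nodes I = {..<n}"
    using gap_instance_sel(2,3)[OF params, folded I_def] by simp_all
  moreover have "valid_policy {..<n} gap_policy"
    using n by (simp add: gap_policy_def)
  ultimately show "\<exists>I \<pi>.
     N \<le> num_nodes I \<and> valid_instance I \<and> valid_policy (nodes I) \<pi> \<and>
     0 < adaptive_probing_cost I \<pi> \<and> 0 < adaptive_clustering_cost I \<pi> \<and>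
     (\<forall>S\<subseteq>nodes I.
        real (num_nodes I) powr 1 * adaptive_probing_cost I \<pi> \<le> nonadaptive_probing_cost I S \<or>
        real (num_nodes I) powr 1 * adaptive_clustering_cost I \<pi> \<le> nonadaptive_clustering_cost I S)"
    using n q valid_gap_instance[OF params, folded I_def]
      adaptive_probing_cost_gap[OF params, folded I_def]
      adaptive_clustering_cost_gap_pos[OF params, folded I_def]
    by (intro exI[of _ I] exI[of _ gap_policy]) simp
qed simp

end
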